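(* Let $\mathbf{M}$ be a countable ultrahomogeneous relational structure. If $\mathbf{M}$ weakly eliminates imaginaries and satisfies the strong cofinite amalgamation property over countable subsets ($\sigma$-SAP), then $\mathrm{Aut}(\mathbf{M})$ is dissociated.
   Context: Let $\Omega=\mathrm{dom}(\mathbf{M})$ be the (countably infinite) domain. $\mathrm{Sym}(\Omega)$ carries the topology of pointwise convergence and $G=\mathrm{Aut}(\mathbf{M})$ is viewed as a closed subgroup of $\mathrm{Sym}(\Omega)$. For $A\subseteq\Omega$, $G_A=\{g\in G: g(a)=a\text{ for all }a\in A\}$. $\mathbf{M}$ is ultrahomogeneous if every isomorphism between finite substructures of $\mathbf{M}$ extends to an automorphism of $\mathbf{M}$. $\mathbf{M}$ (or $G$) weakly eliminates imaginaries if for every open subgroup $V\leq G$ there is a finite $A\subseteq\Omega$ such that $G_A\leq V$ and $[V:G_A]<+\infty$. $\sigma\mathrm{Age}(\mathbf{M})$ is the set of isomorphism classes of countable (finite or infinite) substructures of $\mathbf{M}$. $\mathbf{M}$ has $\sigma$-SAP if, whenever $\mathbf{A},\mathbf{B}_1,\mathbf{B}_2\in\sigma\mathrm{Age}(\mathbf{M})$ and $f_i:\mathbf{A}\to\mathbf{B}_i$ ($i=1,2$) are embeddings with $|\mathrm{dom}(\mathbf{B}_i)\setminus\mathrm{dom}(f_i(\mathbf{A}))|<+\infty$, there exist $\mathbf{C}\in\sigma\mathrm{Age}(\mathbf{M})$ and embeddings $g_i:\mathbf{B}_i\to\mathbf{C}$ such that (1) $g_1\circ f_1=g_2\circ f_2$,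 and (2) for all $b_1\in\mathrm{dom}(\mathbf{B}_1)$, $b_2\in\mathrm{dom}(\mathbf{B}_2)$ with $g_1(b_1)=g_2(b_2)$ there is $a\in\mathrm{dom}(\mathbf{A})$ with $f_1(a)=b_1$ and $f_2(a)=b_2$. A unitary representation of $G$ on a Hilbert space $\mathcal{H}$ is a homomorphism $\pi:G\to\mathcal{U}(\mathcal{H})$ with $g\mapsto\pi(g)\xi$ continuous for all $\xi$. It is dissociated if $p_Ap_B=p_{A\cap B}$ for all finite $A,B\subseteq\Omega$, where $p_A$ is the orthogonal projection onto $\mathcal{H}_A=\{\xi\in\mathcal{H}:\pi(g)\xi=\xi\text{ for all }g\in G_A\}$. $G$ is dissociated if all of its unitary representations are dissociated. *)

theory Defs
  imports "HOL-Analysis.Analysis" "HOL-Algebra.Bij" "HOL-Algebra.Coset"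
begin

section \<open>Complex Hilbert spaces\<close>

text \<open>
  HOL-Analysis only has real inner product spaces. The topology and completeness below are those
  of the underlying real normed space, whose norm is the one induced by \<open>cinner\<close>;
  \<open>cinner\<close> is linear in its first argument.
\<close>

class complex_inner = real_normed_vector +
  fixes scaleC :: "complex \<Rightarrow> 'a \<Rightarrow> 'a" (infixr "*\<^sub>C" 75)
    and cinner :: "'a \<Rightarrow> 'a \<Rightarrow> complex"
  assumes scaleC_add_right: "c *\<^sub>C (x + y) = c *\<^sub>C x + c *\<^sub>C y"
    and scaleC_add_left: "(c + d) *\<^sub>C x = c *\<^sub>C x + d *\<^sub>C x"
    and scaleC_scaleC: "c *\<^sub>C (d *\<^sub>C x) = (c * d) *\<^sub>C x"
    and scaleC_of_real: "complex_of_real r *\<^sub>C x = r *\<^sub>R x"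
    and cinner_commute: "cinner x y = cnj (cinner y x)"
    and cinner_add_left: "cinner (x + y) z = cinner x z + cinner y z"
    and cinner_scaleC_left: "cinner (c *\<^sub>C x) y = c * cinner x y"
    and cinner_self: "cinner x x = complex_of_real ((norm x)\<^sup>2)"

class chilbert_space = complex_inner + complete_space

instantiation complex :: chilbert_space
begin

definition scaleC_complex :: "complex \<Rightarrow> complex \<Rightarrow> complex"
  where "scaleC_complex c x = c * x"

definition cinner_complex :: "complex \<Rightarrow> complex \<Rightarrow> complex"
  where "cinner_complex x y = x * cnj y"

instance
  by standard
    (simp_all add: scaleC_complex_def cinner_complex_def algebra_simps scaleR_conv_of_real
      complex_norm_square[symmetric])

end

definition unitary :: "('h::chilbert_space \<Rightarrow> 'h) \<Rightarrow> bool" where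
  "unitary U \<longleftrightarrow>
     (\<forall>x y. U (x + y) = U x + U y) \<and>
     (\<forall>c x. U (c *\<^sub>C x) = c *\<^sub>C U x) \<and>
     (\<forall>x y. cinner (U x) (U y) = cinner x y) \<and>
     surj U"

definition unitary_group :: "('h::chilbert_space \<Rightarrow> 'h) monoid" where
  "unitary_group = \<lparr>carrier = {U. unitary U}, mult = (\<circ>), one = id\<rparr>"

text \<open>
  The orthogonal projection onto a closed complex subspace \<open>S\<close>; for other sets \<open>S\<close> the value
  is unspecified.
\<close>

definition orth_proj :: "'h::chilbert_space set \<Rightarrow> 'h \<Rightarrow> 'h" where
  "orth_proj S x = (THE p. p \<in> S \<and> (\<forall>y\<in>S. cinner (x - p) y = 0))"

section \<open>Relational structures\<close>

text \<open>
  A structure over the language with relation symbols \<open>'r\<close> interprets each symbol by a set of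
  tuples, represented as lists; the arities are given by a function \<open>ar\<close>.
\<close>

record ('a, 'r) rel_structure =
  universe :: "'a set"
  rel :: "'r \<Rightarrow> 'a list set"

definition relational_structure :: "('r \<Rightarrow> nat) \<Rightarrow> ('a, 'r) rel_structure \<Rightarrow> bool" where
  "relational_structure ar M \<longleftrightarrow>
     (\<forall>r. rel M r \<subseteq> {xs. length xs = ar r \<and> set xs \<subseteq> universe M})"

definition substructure :: "('a, 'r) rel_structure \<Rightarrow> 'a set \<Rightarrow> ('a, 'r) rel_structure" where
  "substructure M A = \<lparr>universe = A, rel = (\<lambda>r. {xs \<in> rel M r. set xs \<subseteq> A})\<rparr>"

text \<open>Only the restriction of \<open>f\<close> to the universe of \<open>A\<close> matters in the following two notions.\<close>

definition embedding ::
  "('a \<Rightarrow> 'b) \<Rightarrow> ('a, 'r) rel_structure \<Rightarrow> ('b, 'r) rel_structure \<Rightarrow> bool" where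
  "embedding f A B \<longleftrightarrow>
     inj_on f (universe A) \<and> f ` universe A \<subseteq> universe B \<and>
     (\<forall>r xs. set xs \<subseteq> universe A \<longrightarrow> (xs \<in> rel A r \<longleftrightarrow> map f xs \<in> rel B r))"

definition isomorphism ::
  "('a \<Rightarrow> 'b) \<Rightarrow> ('a, 'r) rel_structure \<Rightarrow> ('b, 'r) rel_structure \<Rightarrow> bool" where
  "isomorphism f A B \<longleftrightarrow> embedding f A B \<and> f ` universe A = universe B"

text \<open>
  \<^term>\<open>BijGroup \<Omega>\<close> is the symmetric group of \<open>\<Omega>\<close>; its elements are the bijections of \<open>\<Omega>\<close>,
  extended by \<^term>\<open>undefined\<close> outside \<open>\<Omega>\<close>.
\<close>

definition Aut :: "('a, 'r) rel_structure \<Rightarrow> ('a \<Rightarrow> 'a) monoid" where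
  "Aut M = BijGroup (universe M)
     \<lparr>carrier := {g \<in> Bij (universe M). isomorphism g M M}\<rparr>"

definition ultrahomogeneous :: "('a, 'r) rel_structure \<Rightarrow> bool" where
  "ultrahomogeneous M \<longleftrightarrow>
     (\<forall>A B f. finite A \<longrightarrow> finite B \<longrightarrow> A \<subseteq> universe M \<longrightarrow> B \<subseteq> universe M \<longrightarrow>
        isomorphism f (substructure M A) (substructure M B) \<longrightarrow>
        (\<exists>g \<in> carrier (Aut M). \<forall>a\<in>A. g a = f a))"

text \<open>
  A structure represents an element of \<open>\<sigma>Age(M)\<close> if it is isomorphic to a countable substructure
  of \<open>M\<close>. Every isomorphism class in \<open>\<sigma>Age(M)\<close> has representatives on subsets of the type \<open>'a\<close>
  carrying \<open>M\<close>, so it is enough to let the structures in \<open>sigma_SAP\<close> live on that type.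
\<close>

definition in_sigma_age ::
  "('r \<Rightarrow> nat) \<Rightarrow> ('b, 'r) rel_structure \<Rightarrow> ('a, 'r) rel_structure \<Rightarrow> bool" where
  "in_sigma_age ar A M \<longleftrightarrow> relational_structure ar A \<and>
     (\<exists>S f. S \<subseteq> universe M \<and> countable S \<and> isomorphism f A (substructure M S))"

definition sigma_SAP :: "('r \<Rightarrow> nat) \<Rightarrow> ('a, 'r) rel_structure \<Rightarrow> bool" where
  "sigma_SAP ar M \<longleftrightarrow>
     (\<forall>(A :: ('a, 'r) rel_structure) (B1 :: ('a, 'r) rel_structure)
        (B2 :: ('a, 'r) rel_structure) f1 f2.
        in_sigma_age ar A M \<longrightarrow> in_sigma_age ar B1 M \<longrightarrow> in_sigma_age ar B2 M \<longrightarrow>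
        embedding f1 A B1 \<longrightarrow> embedding f2 A B2 \<longrightarrow>
        finite (universe B1 - f1 ` universe A) \<longrightarrow>
        finite (universe B2 - f2 ` universe A) \<longrightarrow>
        (\<exists>(C :: ('a, 'r) rel_structure) g1 g2.
           in_sigma_age ar C M \<and> embedding g1 B1 C \<and> embedding g2 B2 C \<and>
           (\<forall>a \<in> universe A. g1 (f1 a) = g2 (f2 a)) \<and>
           (\<forall>b1 \<in> universe B1. \<forall>b2 \<in> universe B2. g1 b1 = g2 b2 \<longrightarrow>
              (\<exists>a \<in> universe A. f1 a = b1 \<and> f2 a = b2))))"

section \<open>Permutation groups and their unitary representations\<close>

text \<open>
  In this section \<open>G\<close> is a permutation group on \<open>\<Omega>\<close>, that is, a subgroup of
  \<^term>\<open>BijGroup \<Omega>\<close>.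
\<close>

lemma Aut_subgroup: "subgroup (carrier (Aut M)) (BijGroup (universe M))"
proof -
  interpret group "BijGroup (universe M)" by (rule group_BijGroup)
  let ?U = "universe M"
  have car: "carrier (Aut M) = {g \<in> Bij ?U. isomorphism g M M}"
    by (simp add: Aut_def)
  have bij: "g ` ?U = ?U" if "g \<in> Bij ?U" for g
    using that by (auto simp: Bij_def bij_betw_def)
  show ?thesis
  proof (rule subgroupI)
    show "carrier (Aut M) \<subseteq> carrier (BijGroup ?U)"
      by (auto simp: car BijGroup_def)
    have "map (\<lambda>x\<in>?U. x) xs = xs" if "set xs \<subseteq> ?U" for xs
      using that by (auto intro!: map_idI)
    then have "(\<lambda>x\<in>?U. x) \<in> carrier (Aut M)"
      using id_Bij by (auto simp: car isomorphism_def embedding_def inj_on_def)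
    then show "carrier (Aut M) \<noteq> {}" by blast
  next
    fix g assume "g \<in> carrier (Aut M)"
    then have g: "g \<in> Bij ?U" and iso: "isomorphism g M M" by (auto simp: car)
    let ?h = "\<lambda>x\<in>?U. inv_into ?U g x"
    have h: "?h \<in> Bij ?U" using g by (rule restrict_inv_into_Bij)
    have "xs \<in> rel M r \<longleftrightarrow> map ?h xs \<in> rel M r" if "set xs \<subseteq> ?U" for xs r
    proof -
      have "set (map ?h xs) \<subseteq> ?U"
        using that bij[OF h] by auto
      moreover have "map g (map ?h xs) = xs"
        using that bij[OF g] by (auto intro!: map_idI simp: f_inv_into_f subset_iff)
      ultimately show ?thesis
        using iso unfolding isomorphism_def embedding_def by metis
    qed
    then show "inv\<^bsub>BijGroup ?U\<^esub> g \<in> carrier (Aut M)"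
      using h bij[OF h] g
      by (auto simp: car inv_BijGroup isomorphism_def embedding_def Bij_def bij_betw_def)
  next
    fix g h assume "g \<in> carrier (Aut M)" "h \<in> carrier (Aut M)"
    then have g: "g \<in> Bij ?U" "isomorphism g M M" and h: "h \<in> Bij ?U" "isomorphism h M M"
      by (auto simp: car)
    have gh: "compose ?U g h \<in> Bij ?U" using g h by (simp add: compose_Bij)
    have "xs \<in> rel M r \<longleftrightarrow> map (compose ?U g h) xs \<in> rel M r" if "set xs \<subseteq> ?U" for xs r
    proof -
      have "map (compose ?U g h) xs = map g (map h xs)"
        using that by (auto simp: compose_def)
      moreover have "set (map h xs) \<subseteq> ?U" using that bij[OF h(1)] by auto
      ultimately show ?thesis
        using g(2) h(2) that unfolding isomorphism_def embedding_def by metis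
    qed
    moreover have "inj_on (compose ?U g h) ?U"
      using gh by (auto simp: Bij_def bij_betw_def)
    ultimately show "g \<otimes>\<^bsub>BijGroup ?U\<^esub> h \<in> carrier (Aut M)"
      using g h gh bij[OF gh]
      by (simp add: car BijGroup_def isomorphism_def embedding_def)
  qed
qed

definition pointwise_topology :: "'a set \<Rightarrow> ('a \<Rightarrow> 'a) monoid \<Rightarrow> ('a \<Rightarrow> 'a) topology" where
  "pointwise_topology \<Omega> G =
     subtopology (product_topology (\<lambda>_. discrete_topology \<Omega>) \<Omega>) (carrier G)"

definition pt_stabilizer :: "('a \<Rightarrow> 'a) monoid \<Rightarrow> 'a set \<Rightarrow> ('a \<Rightarrow> 'a) set" where
  "pt_stabilizer G A = {g \<in> carrier G. \<forall>a\<in>A. g a = a}"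

definition weakly_eliminates_imaginaries :: "'a set \<Rightarrow> ('a \<Rightarrow> 'a) monoid \<Rightarrow> bool" where
  "weakly_eliminates_imaginaries \<Omega> G \<longleftrightarrow>
     (\<forall>V. subgroup V G \<and> openin (pointwise_topology \<Omega> G) V \<longrightarrow>
        (\<exists>A. finite A \<and> A \<subseteq> \<Omega> \<and> pt_stabilizer G A \<subseteq> V \<and>
             finite (rcosets\<^bsub>G\<lparr>carrier := V\<rparr>\<^esub> (pt_stabilizer G A))))"

definition unitary_rep ::
  "'a set \<Rightarrow> ('a \<Rightarrow> 'a) monoid \<Rightarrow> (('a \<Rightarrow> 'a) \<Rightarrow> 'h::chilbert_space \<Rightarrow> 'h) \<Rightarrow> bool" where
  "unitary_rep \<Omega> G \<pi> \<longleftrightarrow>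
     \<pi> \<in> hom G unitary_group \<and>
     (\<forall>\<xi>. continuous_map (pointwise_topology \<Omega> G) euclidean (\<lambda>g. \<pi> g \<xi>))"

definition fixed_space ::
  "('a \<Rightarrow> 'a) monoid \<Rightarrow> (('a \<Rightarrow> 'a) \<Rightarrow> 'h::chilbert_space \<Rightarrow> 'h) \<Rightarrow> 'a set \<Rightarrow> 'h set" where
  "fixed_space G \<pi> A = {\<xi>. \<forall>g \<in> pt_stabilizer G A. \<pi> g \<xi> = \<xi>}"

definition dissociated_rep ::
  "'a set \<Rightarrow> ('a \<Rightarrow> 'a) monoid \<Rightarrow> (('a \<Rightarrow> 'a) \<Rightarrow> 'h::chilbert_space \<Rightarrow> 'h) \<Rightarrow> bool" where
  "dissociated_rep \<Omega> G \<pi> \<longleftrightarrow>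
     (\<forall>A B. finite A \<longrightarrow> finite B \<longrightarrow> A \<subseteq> \<Omega> \<longrightarrow> B \<subseteq> \<Omega> \<longrightarrow>
        orth_proj (fixed_space G \<pi> A) \<circ> orth_proj (fixed_space G \<pi> B) =
        orth_proj (fixed_space G \<pi> (A \<inter> B)))"

text \<open>
  A definition cannot quantify over types, so the Hilbert space is a type parameter; a group is
  dissociated if this holds for all types \<open>'h\<close> of class \<open>chilbert_space\<close>.
\<close>

definition dissociated ::
  "'h::chilbert_space itself \<Rightarrow> 'a set \<Rightarrow> ('a \<Rightarrow> 'a) monoid \<Rightarrow> bool" where
  "dissociated _ \<Omega> G \<longleftrightarrow>
     (\<forall>\<pi> :: ('a \<Rightarrow> 'a) \<Rightarrow> 'h \<Rightarrow> 'h. unitary_rep \<Omega> G \<pi> \<longrightarrow> dissociated_rep \<Omega> G \<pi>)"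

end

theory Submission
  imports Defs
begin

text \<open>
  Let \<open>\<H>\<^sub>A\<close> be the space of vectors fixed by the pointwise stabilizer of a finite set \<open>A\<close>, and for
  infinite \<open>D\<close> let \<open>\<H>\<^sub>D\<close> be the closure of the union of the \<open>\<H>\<^sub>F\<close> over the finite \<open>F \<subseteq> D\<close>.
  Given finite \<open>A\<close> and \<open>B\<close>, put \<open>C = A \<inter> B\<close> and let \<open>D\<close> be the complement of \<open>B - C\<close>, a cofinite set
  containing \<open>A\<close>.

  Take \<open>y \<in> \<H>\<^sub>B\<close> and let \<open>z\<close> be its projection to \<open>\<H>\<^sub>D\<close>. The pointwise stabilizer of \<open>B\<close> preserves
  \<open>D\<close>, so \<open>z\<close> again lies in \<open>\<H>\<^sub>B\<close>. The heart of the matter is the inclusion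
  \<open>\<H>\<^sub>B \<inter> \<H>\<^sub>D \<subseteq> \<H>\<^sub>C\<close> (lemma \<open>fixed_space_inter_support_space\<close>). It gives
  \<open>z \<in> \<H>\<^sub>C \<subseteq> \<H>\<^sub>A \<subseteq> \<H>\<^sub>D\<close>, so \<open>z\<close> is the projection of \<open>y\<close> to \<open>\<H>\<^sub>A\<close> as well as to \<open>\<H>\<^sub>C\<close>;
  this is the claim.

  For the inclusion, amalgamate two copies of the whole structure over \<open>D\<close>, which leaves out only
  finitely many points. By \<open>\<sigma>\<close>-SAP the amalgam embeds into the structure, and yields two
  self-embeddings \<open>e1\<close>, \<open>e2\<close> that agree on \<open>D\<close> and send \<open>B - C\<close> to disjoint sets (lemma
  \<open>sigma_SAP_splits_finite_sets\<close>). By ultrahomogeneity \<open>e1\<close> and \<open>e2\<close> are pointwise limits of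
  automorphisms. Let \<open>\<xi> \<in> \<H>\<^sub>B \<inter> \<H>\<^sub>D\<close>, and let \<open>h1\<close>, \<open>h2\<close> be automorphisms that agree with \<open>e1\<close>,
  \<open>e2\<close> on \<open>B\<close>. As \<open>\<xi>\<close> is a limit of vectors supported on finite subsets of \<open>D\<close>, where \<open>e1\<close> and
  \<open>e2\<close> agree, \<open>h1\<close> and \<open>h2\<close> move \<open>\<xi>\<close> to the same vector; that is, \<open>h1\<^sup>-\<^sup>1 h2\<close> lies in the
  stabilizer \<open>V\<close> of \<open>\<xi>\<close>.

  Now \<open>V\<close> is open, since it contains the pointwise stabilizer of \<open>B\<close>. By weak elimination of
  imaginaries, the pointwise stabilizer of some finite \<open>E\<close> has finite index in \<open>V\<close>. Hence the union
  \<open>S\<close> of the \<open>V\<close>-orbits that meet \<open>E\<close> is finite. A finite set invariant under the pointwise stabilizer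
  of \<open>B\<close> lies in \<open>B\<close>: this is the absence of algebraicity, again a consequence of splitting
  (lemma \<open>no_algebraicity\<close>). So \<open>S \<subseteq> B\<close>, and invariance under \<open>h1\<^sup>-\<^sup>1 h2\<close> says
  that \<open>e1\<close> and \<open>e2\<close> have the same image of \<open>S\<close>. Since \<open>e1\<close> takes no value on \<open>B - C\<close> that \<open>e2\<close>
  takes anywhere, \<open>S\<close> is contained in \<open>C\<close>, and so the pointwise stabilizer of \<open>C\<close> fixes \<open>\<xi>\<close>.
\<close>

section \<open>Orthogonal projections in complex Hilbert spaces\<close>

lemma cinner_minus_left: "cinner (- x) z = - cinner x z" for x z :: "'h::complex_inner"
proof -
  have "cinner 0 z = 0" using cinner_add_left[of 0 0 z] by simp
  then show ?thesis using cinner_add_left[of x "- x" z]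
    by (simp add: eq_neg_iff_add_eq_0 add.commute)
qed

lemma cinner_diff_left: "cinner (x - y) z = cinner x z - cinner y z" for x y z :: "'h::complex_inner"
  using cinner_add_left[of x "- y" z] by (simp add: cinner_minus_left)

lemma cinner_add_right: "cinner z (x + y) = cinner z x + cinner z y" for x y z :: "'h::complex_inner"
  by (metis cinner_add_left cinner_commute complex_cnj_add)

lemma cinner_diff_right: "cinner z (x - y) = cinner z x - cinner z y" for x y z :: "'h::complex_inner"
  by (metis cinner_commute cinner_diff_left complex_cnj_diff)

lemma cinner_scaleC_right: "cinner x (c *\<^sub>C y) = cnj c * cinner x y" for x y :: "'h::complex_inner"
  by (metis cinner_commute cinner_scaleC_left complex_cnj_mult)

lemma cinner_self_eq_0: "cinner x x = 0 \<longleftrightarrow> x = 0" for x :: "'h::complex_inner"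
  by (simp add: cinner_self)

lemma norm_scaleC: "norm (c *\<^sub>C x) = cmod c * norm x" for x :: "'h::complex_inner"
proof -
  have "complex_of_real ((norm (c *\<^sub>C x))\<^sup>2) = complex_of_real ((cmod c * norm x)\<^sup>2)"
    unfolding cinner_self[symmetric] cinner_scaleC_left cinner_scaleC_right
    by (simp add: cinner_self power_mult_distrib complex_norm_square del: of_real_power)
  then have "(norm (c *\<^sub>C x))\<^sup>2 = (cmod c * norm x)\<^sup>2"
    using of_real_eq_iff by blast
  then show ?thesis
    by (simp add: power2_eq_iff_nonneg)
qed

lemma parallelogram_law:
  "(norm (x + y))\<^sup>2 + (norm (x - y))\<^sup>2 = 2 * (norm x)\<^sup>2 + 2 * (norm y)\<^sup>2"
  for x y :: "'h::complex_inner"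
proof -
  have "complex_of_real ((norm (x + y))\<^sup>2 + (norm (x - y))\<^sup>2)
      = complex_of_real (2 * (norm x)\<^sup>2 + 2 * (norm y)\<^sup>2)"
    unfolding of_real_add of_real_mult cinner_self[symmetric]
    by (simp add: cinner_add_left cinner_diff_left cinner_add_right cinner_diff_right)
  then show ?thesis using of_real_eq_iff by blast
qed

definition csubspace :: "'h::complex_inner set \<Rightarrow> bool" where
  "csubspace S \<longleftrightarrow> 0 \<in> S \<and> (\<forall>x\<in>S. \<forall>y\<in>S. x + y \<in> S) \<and> (\<forall>c. \<forall>x\<in>S. c *\<^sub>C x \<in> S)"

lemma csubspace_scaleR: "csubspace S \<Longrightarrow> x \<in> S \<Longrightarrow> r *\<^sub>R x \<in> S"
  by (metis csubspace_def scaleC_of_real)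

lemma csubspace_diff: "csubspace S \<Longrightarrow> x \<in> S \<Longrightarrow> y \<in> S \<Longrightarrow> x - y \<in> S"
  using csubspace_scaleR[of S y "-1"] unfolding csubspace_def
  by (metis scaleR_minus1_left uminus_add_conv_diff add.commute)

text \<open>
  Existence in the projection theorem: a sequence in \<open>S\<close> minimising the distance to \<open>x\<close> is Cauchy
  by the parallelogram law, because midpoints stay in \<open>S\<close>.
\<close>

lemma nearest_point_exists:
  fixes x :: "'h::chilbert_space"
  assumes "csubspace S" "closed S"
  shows "\<exists>p\<in>S. \<forall>y\<in>S. norm (x - p) \<le> norm (x - y)"
proof -
  define d where "d = infdist x S"
  have ne: "S \<noteq> {}" using assms by (auto simp: csubspace_def)
  have d_le: "d \<le> norm (x - y)" if "y \<in> S" for y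
    using infdist_le[OF that] by (simp add: d_def dist_norm)
  have d0: "0 \<le> d" by (simp add: d_def infdist_nonneg)
  have "\<exists>y\<in>S. norm (x - y) < d + inverse (real (Suc n))" for n
    using cInf_lessD[of "dist x ` S" "d + inverse (real (Suc n))"] ne
    by (auto simp: d_def infdist_notempty dist_norm)
  then obtain Y where Y: "\<And>n. Y n \<in> S" "\<And>n. norm (x - Y n) < d + inverse (real (Suc n))"
    by metis
  have lim0: "(\<lambda>n. inverse (real (Suc n))) \<longlonglongrightarrow> 0" by (rule LIMSEQ_inverse_real_of_nat)
  have close: "(norm (Y m - Y n))\<^sup>2 \<le> 4 * ((d + e)\<^sup>2 - d\<^sup>2)"
    if "inverse (real (Suc m)) \<le> e" "inverse (real (Suc n)) \<le> e" for m n e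
  proof -
    have "(1/2) *\<^sub>R (Y m + Y n) \<in> S"
      using assms Y csubspace_scaleR unfolding csubspace_def by blast
    then have "2 * d \<le> 2 * norm (x - (1/2) *\<^sub>R (Y m + Y n))" using d_le by simp
    also have "\<dots> = norm (2 *\<^sub>R (x - (1/2) *\<^sub>R (Y m + Y n)))" by simp
    also have "2 *\<^sub>R (x - (1/2) *\<^sub>R (Y m + Y n)) = (x - Y m) + (x - Y n)"
      by (simp add: algebra_simps scaleR_2)
    finally have "(2 * d)\<^sup>2 \<le> (norm ((x - Y m) + (x - Y n)))\<^sup>2"
      using d0 by (intro power_mono) auto
    moreover have "(norm (x - Y m))\<^sup>2 \<le> (d + e)\<^sup>2" "(norm (x - Y n))\<^sup>2 \<le> (d + e)\<^sup>2"
      using Y(2)[of m] Y(2)[of n] that by (intro power_mono; simp)+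
    moreover have "norm (Y m - Y n) = norm ((x - Y m) - (x - Y n))"
      by (simp add: norm_minus_commute)
    ultimately show ?thesis
      using parallelogram_law[of "x - Y m" "x - Y n"] by (simp add: power2_eq_square)
  qed
  have "Cauchy Y"
  proof (rule metric_CauchyI)
    fix r :: real assume r: "0 < r"
    have "(\<lambda>n. 4 * ((d + inverse (real (Suc n)))\<^sup>2 - d\<^sup>2)) \<longlonglongrightarrow> 4 * ((d + 0)\<^sup>2 - d\<^sup>2)"
      by (intro tendsto_intros lim0)
    then have "\<forall>\<^sub>F n in sequentially. 4 * ((d + inverse (real (Suc n)))\<^sup>2 - d\<^sup>2) < r\<^sup>2"
      using r by (intro order_tendstoD(2)) auto
    then obtain N where N: "4 * ((d + inverse (real (Suc N)))\<^sup>2 - d\<^sup>2) < r\<^sup>2"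
      by (auto simp: eventually_sequentially)
    show "\<exists>M. \<forall>m\<ge>M. \<forall>n\<ge>M. dist (Y m) (Y n) < r"
    proof (intro exI allI impI)
      fix m n assume "N \<le> m" "N \<le> n"
      then have "(norm (Y m - Y n))\<^sup>2 < r\<^sup>2"
        using close[of m "inverse (real (Suc N))" n] N by (simp add: le_imp_inverse_le)
      then show "dist (Y m) (Y n) < r"
        using r by (simp add: dist_norm power2_less_imp_less)
    qed
  qed
  then obtain p where p: "Y \<longlonglongrightarrow> p" using convergent_eq_Cauchy by blast
  have "p \<in> S" using closed_sequentially[OF assms(2)] Y(1) p by blast
  moreover have "norm (x - p) \<le> d + 0"
  proof (rule LIMSEQ_le)
    show "(\<lambda>n. norm (x - Y n)) \<longlonglongrightarrow> norm (x - p)" by (intro tendsto_intros p)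
    show "(\<lambda>n. d + inverse (real (Suc n))) \<longlonglongrightarrow> d + 0" by (intro tendsto_intros lim0)
    show "\<exists>N. \<forall>n\<ge>N. norm (x - Y n) \<le> d + inverse (real (Suc n))"
      using Y(2) less_imp_le by blast
  qed
  ultimately show ?thesis using d_le by force
qed

text \<open>
  If \<open>x - p\<close> had a component along \<open>y\<close>, moving \<open>p\<close> in that direction would bring it closer to \<open>x\<close>.
\<close>

lemma nearest_point_orthogonal:
  fixes x :: "'h::complex_inner"
  assumes S: "csubspace S" and p: "p \<in> S" "\<forall>y\<in>S. norm (x - p) \<le> norm (x - y)" and y: "y \<in> S"
  shows "cinner (x - p) y = 0"
proof (cases "y = 0")
  case True
  then show ?thesis using cinner_add_right[of "x - p" 0 0] by simp
next
  case False
  define u where "u = x - p"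
  \<comment> \<open>\<open>c\<close> is the coefficient of the projection of \<open>u\<close> onto the line spanned by \<open>y\<close>.\<close>
  define c where "c = cinner u y / complex_of_real ((norm y)\<^sup>2)"
  have cy: "c * cinner y y = cinner u y" using False by (simp add: c_def cinner_self)
  have "p + c *\<^sub>C y \<in> S" using S p y by (auto simp: csubspace_def)
  then have "norm u \<le> norm (u - c *\<^sub>C y)"
    using p(2) by (metis diff_diff_eq u_def)
  then have le: "(norm u)\<^sup>2 \<le> (norm (u - c *\<^sub>C y))\<^sup>2" by (intro power_mono) auto
  have "cinner (u - c *\<^sub>C y) (c *\<^sub>C y) = 0"
    by (simp add: cinner_diff_left cinner_scaleC_left cinner_scaleC_right algebra_simps flip: cy)
  then have "cinner u u = cinner (u - c *\<^sub>C y) (u - c *\<^sub>C y) + cinner (c *\<^sub>C y) (c *\<^sub>C y)"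
    using cinner_commute[of "u - c *\<^sub>C y" "c *\<^sub>C y"]
    by (simp add: cinner_diff_left cinner_diff_right algebra_simps)
  then have "complex_of_real ((norm u)\<^sup>2) =
      complex_of_real ((norm (u - c *\<^sub>C y))\<^sup>2 + (norm (c *\<^sub>C y))\<^sup>2)"
    unfolding cinner_self of_real_add .
  then have "(norm u)\<^sup>2 = (norm (u - c *\<^sub>C y))\<^sup>2 + (norm (c *\<^sub>C y))\<^sup>2"
    using of_real_eq_iff by blast
  then have "norm (c *\<^sub>C y) = 0" using le by simp
  then have "c = 0" using False by (simp add: norm_scaleC)
  then show ?thesis using cy by (simp add: u_def)
qed

lemma orth_proj_eqI:
  assumes S: "csubspace S" and p: "p \<in> S" "\<And>y. y \<in> S \<Longrightarrow> cinner (x - p) y = 0"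
  shows "orth_proj S x = p"
  unfolding orth_proj_def
proof (rule the_equality)
  show "p \<in> S \<and> (\<forall>y\<in>S. cinner (x - p) y = 0)" using p by blast
  fix q assume q: "q \<in> S \<and> (\<forall>y\<in>S. cinner (x - q) y = 0)"
  then have "p - q \<in> S" using S p(1) csubspace_diff by blast
  then have "cinner (x - q) (p - q) - cinner (x - p) (p - q) = 0" using p q by simp
  then have "cinner (p - q) (p - q) = 0" by (simp flip: cinner_diff_left)
  then show "q = p" by (simp add: cinner_self_eq_0)
qed

lemma orth_proj_props:
  fixes x :: "'h::chilbert_space"
  assumes "csubspace S" "closed S"
  shows "orth_proj S x \<in> S" "\<And>y. y \<in> S \<Longrightarrow> cinner (x - orth_proj S x) y = 0"
proof -
  obtain p where p: "p \<in> S" "\<forall>y\<in>S. norm (x - p) \<le> norm (x - y)"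
    using nearest_point_exists[OF assms] by blast
  have o: "cinner (x - p) y = 0" if "y \<in> S" for y
    using nearest_point_orthogonal[OF assms(1) p that] .
  then have e: "orth_proj S x = p" using orth_proj_eqI[OF assms(1) p(1)] by blast
  show "orth_proj S x \<in> S" "\<And>y. y \<in> S \<Longrightarrow> cinner (x - orth_proj S x) y = 0"
    using p o e by auto
qed

lemma csubspace_closure:
  fixes S :: "'h::complex_inner set"
  assumes S: "csubspace S"
  shows "csubspace (closure S)"
  unfolding csubspace_def
proof (intro conjI ballI allI)
  show "0 \<in> closure S" using S closure_subset by (force simp: csubspace_def)
next
  fix x y assume "x \<in> closure S" "y \<in> closure S"
  then obtain X Y where "\<forall>n. X n \<in> S" "X \<longlonglongrightarrow> x" "\<forall>n. Y n \<in> S" "Y \<longlonglongrightarrow> y"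
    unfolding closure_sequential by blast
  then have "(\<forall>n. X n + Y n \<in> S) \<and> (\<lambda>n. X n + Y n) \<longlonglongrightarrow> x + y"
    using S by (auto simp: csubspace_def intro: tendsto_add)
  then show "x + y \<in> closure S"
    unfolding closure_sequential by (intro exI[of _ "\<lambda>n. X n + Y n"])
next
  fix c x assume "x \<in> closure S"
  then obtain X where X: "\<forall>n. X n \<in> S" "X \<longlonglongrightarrow> x" unfolding closure_sequential by blast
  have "bounded_linear (\<lambda>v :: 'h. c *\<^sub>C v)"
  proof (rule bounded_linear_intro)
    show "c *\<^sub>C (r *\<^sub>R v) = r *\<^sub>R (c *\<^sub>C v)" for r and v :: 'h
      by (simp add: scaleC_scaleC mult.commute flip: scaleC_of_real)
    show "norm (c *\<^sub>C v) \<le> norm v * cmod c" for v :: 'h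
      by (simp add: norm_scaleC)
  qed (rule scaleC_add_right)
  then have "(\<forall>n. c *\<^sub>C X n \<in> S) \<and> (\<lambda>n. c *\<^sub>C X n) \<longlonglongrightarrow> c *\<^sub>C x"
    using S X bounded_linear.tendsto by (auto simp: csubspace_def)
  then show "c *\<^sub>C x \<in> closure S"
    unfolding closure_sequential by (intro exI[of _ "\<lambda>n. c *\<^sub>C X n"])
qed

lemma unitary_norm_diff: "unitary U \<Longrightarrow> norm (U x - U y) = norm (x - y)"
proof -
  assume U: "unitary U"
  have "U (x - y) = U x - U y"
    using U unfolding unitary_def by (metis add_diff_cancel_right' diff_add_cancel)
  moreover have "complex_of_real ((norm (U (x - y)))\<^sup>2) = complex_of_real ((norm (x - y))\<^sup>2)"
    using U unfolding unitary_def cinner_self[symmetric] by blast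
  then have "(norm (U (x - y)))\<^sup>2 = (norm (x - y))\<^sup>2" using of_real_eq_iff by blast
  ultimately show ?thesis by (simp add: power2_eq_iff_nonneg)
qed

lemma unitary_continuous: "unitary U \<Longrightarrow> continuous_on S U"
  unfolding continuous_on_iff by (metis dist_norm unitary_norm_diff)


section \<open>Permutation groups and splitting of finite sets\<close>

locale permutation_group =
  fixes \<Omega> :: "'a set" and G :: "('a \<Rightarrow> 'a) monoid" (structure)
  assumes carrier_update: "G = BijGroup \<Omega>\<lparr>carrier := carrier G\<rparr>"
    and carrier_subgroup: "subgroup (carrier G) (BijGroup \<Omega>)"
begin

sublocale group G
  using group.subgroup_imp_group[OF group_BijGroup carrier_subgroup]
  by (simp add: carrier_update[symmetric])

lemma carrier_Bij: "g \<in> carrier G \<Longrightarrow> g \<in> Bij \<Omega>"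
  using subgroup.subset[OF carrier_subgroup] by (auto simp: BijGroup_def)

lemma apply_closed: "g \<in> carrier G \<Longrightarrow> x \<in> \<Omega> \<Longrightarrow> g x \<in> \<Omega>"
  using carrier_Bij by (auto simp: Bij_def bij_betw_def)

lemma mult_apply: "g \<in> carrier G \<Longrightarrow> h \<in> carrier G \<Longrightarrow> x \<in> \<Omega> \<Longrightarrow> (g \<otimes> h) x = g (h x)"
  using arg_cong[OF carrier_update, of mult] carrier_Bij
  by (simp add: BijGroup_def compose_def)

lemma one_apply: "x \<in> \<Omega> \<Longrightarrow> \<one> x = x"
  using arg_cong[OF carrier_update, of one] by (simp add: BijGroup_def)

lemma inv_apply: "g \<in> carrier G \<Longrightarrow> x \<in> \<Omega> \<Longrightarrow> (inv g) (g x) = x"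
  by (metis inv_closed l_inv mult_apply one_apply)

lemma apply_inv: "g \<in> carrier G \<Longrightarrow> x \<in> \<Omega> \<Longrightarrow> g ((inv g) x) = x"
  by (metis inv_closed r_inv mult_apply one_apply)

lemma inv_mult_stabilizes:
  assumes "g \<in> carrier G" "h \<in> carrier G" "A \<subseteq> \<Omega>" "\<And>a. a \<in> A \<Longrightarrow> g a = h a"
  shows "inv g \<otimes> h \<in> pt_stabilizer G A"
  using assms by (auto simp: pt_stabilizer_def mult_apply subset_iff) (metis inv_apply)

lemma openin_pointwise_topology:
  assumes V: "V \<subseteq> carrier G" and A: "finite A" "A \<subseteq> \<Omega>"
    and nbhd: "\<And>v g. v \<in> V \<Longrightarrow> g \<in> carrier G \<Longrightarrow> (\<And>a. a \<in> A \<Longrightarrow> g a = v a) \<Longrightarrow> g \<in> V"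
  shows "openin (pointwise_topology \<Omega> G) V"
proof -
  define N where "N v = (\<Pi>\<^sub>E x\<in>\<Omega>. if x \<in> A then {v x} else \<Omega>)" for v :: "'a \<Rightarrow> 'a"
  have ext: "g \<in> N g" if "g \<in> carrier G" for g
    using carrier_Bij[OF that] apply_closed[OF that]
    by (auto simp: N_def Bij_def extensional_def PiE_iff)
  have "openin (product_topology (\<lambda>_. discrete_topology \<Omega>) \<Omega>) (N v)" if "v \<in> V" for v
    unfolding N_def
  proof (rule product_topology_basis)
    show "openin (discrete_topology \<Omega>) (if x \<in> A then {v x} else \<Omega>)" for x
      using that V A apply_closed by auto
    show "finite {x. (if x \<in> A then {v x} else \<Omega>) \<noteq> topspace (discrete_topology \<Omega>)}"
      by (rule finite_subset[OF _ A(1)]) auto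
  qed
  then have "openin (product_topology (\<lambda>_. discrete_topology \<Omega>) \<Omega>) (\<Union>v\<in>V. N v)"
    by blast
  moreover have "V = (\<Union>v\<in>V. N v) \<inter> carrier G"
  proof (intro equalityI subsetI)
    fix g assume "g \<in> (\<Union>v\<in>V. N v) \<inter> carrier G"
    then obtain v where v: "v \<in> V" "g \<in> N v" and g: "g \<in> carrier G" by blast
    have "g a = v a" if "a \<in> A" for a
      using v(2) that A(2) PiE_mem[of g \<Omega> _ a] unfolding N_def by (fastforce split: if_splits)
    then show "g \<in> V" using nbhd v(1) g by blast
  qed (use V ext in auto)
  ultimately show ?thesis
    unfolding pointwise_topology_def openin_subtopology by blast
qed

text \<open>
  The maps approximated by \<open>G\<close> on finite sets are the elements of the closure of \<open>G\<close> among all maps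
  of \<open>\<Omega>\<close> into itself; for an ultrahomogeneous structure these are its self-embeddings.
\<close>

definition finitely_approximated :: "('a \<Rightarrow> 'a) \<Rightarrow> bool" where
  "finitely_approximated e \<longleftrightarrow>
     (\<forall>F. finite F \<longrightarrow> F \<subseteq> \<Omega> \<longrightarrow> (\<exists>g\<in>carrier G. \<forall>x\<in>F. g x = e x))"

lemma finitely_approximatedE:
  assumes "finitely_approximated e" "finite F" "F \<subseteq> \<Omega>"
  obtains g where "g \<in> carrier G" "\<forall>x\<in>F. g x = e x"
  using assms(1)[unfolded finitely_approximated_def, rule_format, OF assms(2,3)] by (elim bexE)

text \<open>
  Two copies of \<open>\<Omega>\<close> are placed inside \<open>\<Omega>\<close> so that they share exactly the points outside \<open>S\<close>. The point
  of having limits of group elements here, and not just group elements, is that \<open>e1\<close> and \<open>e2\<close> agree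
  on the whole infinite complement of \<open>S\<close>.
\<close>

definition splits_finite_sets :: bool where
  "splits_finite_sets \<longleftrightarrow>
     (\<forall>S. finite S \<longrightarrow> S \<subseteq> \<Omega> \<longrightarrow>
        (\<exists>e1 e2. finitely_approximated e1 \<and> finitely_approximated e2 \<and>
           (\<forall>x\<in>\<Omega> - S. e1 x = e2 x) \<and>
           (\<forall>x\<in>\<Omega>. \<forall>y\<in>\<Omega>. e1 x = e2 y \<longrightarrow> x = y \<and> x \<notin> S)))"

lemma splits_finite_setsE:
  assumes "splits_finite_sets" "finite S" "S \<subseteq> \<Omega>"
  obtains e1 e2 where "finitely_approximated e1" "finitely_approximated e2"
    "\<forall>x\<in>\<Omega> - S. e1 x = e2 x"
    "\<forall>x\<in>\<Omega>. \<forall>y\<in>\<Omega>. e1 x = e2 y \<longrightarrow> x = y \<and> x \<notin> S"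
  using assms(1)[unfolded splits_finite_sets_def, rule_format, OF assms(2,3)] by (elim exE conjE)

text \<open>
  The stabilizer of \<open>A\<close> contains an element that maps \<open>S\<close> off itself: approximate the two maps that
  split \<open>S\<close> by \<open>k1\<close> and \<open>k2\<close> on \<open>A \<union> S\<close>, and take \<open>inv k1 \<otimes> k2\<close>.
\<close>

lemma no_algebraicity:
  assumes split: "splits_finite_sets" and fin: "finite A" "A \<subseteq> \<Omega>" "finite S" "S \<subseteq> \<Omega>"
    and disj: "A \<inter> S = {}"
    and inv: "\<And>g s. g \<in> pt_stabilizer G A \<Longrightarrow> s \<in> S \<Longrightarrow> g s \<in> S"
  shows "S = {}"
proof (rule ccontr)
  assume "S \<noteq> {}"
  then obtain s where s: "s \<in> S" by blast
  obtain e1 e2 where e: "finitely_approximated e1" "finitely_approximated e2"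
    and eq: "\<forall>x\<in>\<Omega> - S. e1 x = e2 x"
    and sep: "\<forall>x\<in>\<Omega>. \<forall>y\<in>\<Omega>. e1 x = e2 y \<longrightarrow> x = y \<and> x \<notin> S"
    by (rule splits_finite_setsE[OF split fin(3,4)])
  have AS: "finite (A \<union> S)" "A \<union> S \<subseteq> \<Omega>" using fin by auto
  obtain k1 where k1: "k1 \<in> carrier G" "\<forall>x\<in>A \<union> S. k1 x = e1 x"
    by (rule finitely_approximatedE[OF e(1) AS])
  obtain k2 where k2: "k2 \<in> carrier G" "\<forall>x\<in>A \<union> S. k2 x = e2 x"
    by (rule finitely_approximatedE[OF e(2) AS])
  let ?g = "inv k1 \<otimes> k2"
  have "k1 a = k2 a" if "a \<in> A" for a
  proof -
    have "a \<in> \<Omega> - S" using that fin disj by auto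
    then show ?thesis using eq k1(2) k2(2) that by simp
  qed
  then have "?g \<in> pt_stabilizer G A"
    using inv_mult_stabilizes k1(1) k2(1) fin(2) by blast
  then have gs: "?g s \<in> S" using inv s by blast
  have "e1 (?g s) = k1 (?g s)" using gs k1(2) by auto
  also have "\<dots> = k2 s"
    using k1(1) k2(1) s fin(4) by (simp add: mult_apply apply_inv apply_closed subset_iff)
  also have "\<dots> = e2 s" using s k2(2) by auto
  finally show False using sep[rule_format, of "?g s" s] gs s fin(4) by blast
qed

text \<open>
  The value of \<open>v \<in> V\<close> at a point of \<open>D\<close> depends only on the coset of \<open>v\<close> modulo the pointwise
  stabilizer of \<open>D\<close>, and there are finitely many cosets.
\<close>

lemma finite_index_orbit:
  assumes V: "subgroup V G" and D: "finite D" "D \<subseteq> \<Omega>"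
    and idx: "finite (rcosets\<^bsub>G\<lparr>carrier := V\<rparr>\<^esub> (pt_stabilizer G D))"
  shows "finite {v d | v d. v \<in> V \<and> d \<in> D}"
proof -
  let ?R = "rcosets\<^bsub>G\<lparr>carrier := V\<rparr>\<^esub> (pt_stabilizer G D)"
  have VG: "v \<in> carrier G" if "v \<in> V" for v using subgroup.subset[OF V] that by blast
  \<comment> \<open>The cosets are right cosets, which determine the restriction to \<open>D\<close> of the inverse of \<open>v\<close>.\<close>
  have coset: "(inv k) d = (inv v) d"
    if v: "v \<in> V" and k: "k \<in> pt_stabilizer G D #>\<^bsub>G\<lparr>carrier := V\<rparr>\<^esub> v" and dD: "d \<in> D"
    for k v d
  proof -
    obtain h where h: "h \<in> pt_stabilizer G D" "k = h \<otimes> v"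
      using k by (auto simp: r_coset_def)
    then have hG: "h \<in> carrier G" "h d = d" and d: "d \<in> \<Omega>"
      using dD D by (auto simp: pt_stabilizer_def)
    have "(inv h) d = d" using inv_apply[OF hG(1) d] hG(2) by simp
    then show ?thesis
      using h(2) hG(1) VG[OF v] d by (simp add: inv_mult_group mult_apply)
  qed
  have "finite {(inv k) d | k d. k \<in> K \<and> d \<in> D}" if "K \<in> ?R" for K
  proof -
    obtain v where v: "v \<in> V" "K = pt_stabilizer G D #>\<^bsub>G\<lparr>carrier := V\<rparr>\<^esub> v"
      using \<open>K \<in> ?R\<close> by (auto simp: RCOSETS_def)
    have "{(inv k) d | k d. k \<in> K \<and> d \<in> D} \<subseteq> (inv v) ` D" using coset[OF v(1)] v(2) by auto
    then show ?thesis using D(1) finite_subset by blast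
  qed
  then have "finite (\<Union>K\<in>?R. {(inv k) d | k d. k \<in> K \<and> d \<in> D})" using idx by blast
  moreover have "{v d | v d. v \<in> V \<and> d \<in> D} \<subseteq> (\<Union>K\<in>?R. {(inv k) d | k d. k \<in> K \<and> d \<in> D})"
  proof clarify
    fix v d assume v: "v \<in> V" and d: "d \<in> D"
    let ?K = "pt_stabilizer G D #>\<^bsub>G\<lparr>carrier := V\<rparr>\<^esub> inv v"
    have iv: "inv v \<in> V" using V v by (rule subgroup.m_inv_closed)
    have "\<one> \<in> pt_stabilizer G D" using D one_apply by (auto simp: pt_stabilizer_def)
    moreover have "\<one> \<otimes> inv v = inv v" using VG[OF v] by simp
    ultimately have "inv v \<in> ?K" by (force simp: r_coset_def)
    moreover have "?K \<in> ?R" using iv by (auto simp: RCOSETS_def)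
    moreover have "v d = (inv (inv v)) d" using VG[OF v] by simp
    ultimately show "v d \<in> (\<Union>K\<in>?R. {(inv k) d | k d. k \<in> K \<and> d \<in> D})" using d by blast
  qed
  ultimately show ?thesis using finite_subset by blast
qed

end

section \<open>Spaces of fixed vectors\<close>

locale unitary_representation = permutation_group \<Omega> G
  for \<Omega> :: "'a set" and G :: "('a \<Rightarrow> 'a) monoid" (structure) +
  fixes \<pi> :: "('a \<Rightarrow> 'a) \<Rightarrow> 'h::chilbert_space \<Rightarrow> 'h"
  assumes rep_hom: "\<pi> \<in> hom G unitary_group"
begin

lemma rep_unitary: "g \<in> carrier G \<Longrightarrow> unitary (\<pi> g)"
  using hom_in_carrier[OF rep_hom] by (auto simp: unitary_group_def)

lemma rep_add: "g \<in> carrier G \<Longrightarrow> \<pi> g (x + y) = \<pi> g x + \<pi> g y"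
  using rep_unitary unfolding unitary_def by blast

lemma rep_scaleC: "g \<in> carrier G \<Longrightarrow> \<pi> g (c *\<^sub>C x) = c *\<^sub>C \<pi> g x"
  using rep_unitary unfolding unitary_def by blast

lemma rep_diff: "g \<in> carrier G \<Longrightarrow> \<pi> g (x - y) = \<pi> g x - \<pi> g y"
  using rep_add[of g "x - y" y] by simp

lemma rep_cinner: "g \<in> carrier G \<Longrightarrow> cinner (\<pi> g x) (\<pi> g y) = cinner x y"
  using rep_unitary unfolding unitary_def by blast

lemma rep_mult: "g \<in> carrier G \<Longrightarrow> h \<in> carrier G \<Longrightarrow> \<pi> (g \<otimes> h) \<xi> = \<pi> g (\<pi> h \<xi>)"
  using hom_mult[OF rep_hom] by (simp add: unitary_group_def)

lemma rep_one: "\<pi> \<one> \<xi> = \<xi>"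
proof -
  have "norm (\<pi> \<one> \<xi> - \<xi>) = norm (\<pi> \<one> (\<pi> \<one> \<xi>) - \<pi> \<one> \<xi>)"
    by (simp add: unitary_norm_diff rep_unitary)
  also have "\<dots> = 0" using rep_mult[of \<one> \<one> \<xi>] by simp
  finally show ?thesis by simp
qed

lemma rep_inv:
  "g \<in> carrier G \<Longrightarrow> \<pi> (inv g) (\<pi> g \<xi>) = \<xi>"
  "g \<in> carrier G \<Longrightarrow> \<pi> g (\<pi> (inv g) \<xi>) = \<xi>"
  by (simp_all add: rep_one flip: rep_mult)

lemma fixed_space_csubspace: "csubspace (fixed_space G \<pi> A)"
proof -
  have "\<pi> g 0 = 0" if "g \<in> carrier G" for g using rep_diff[OF that, of 0 0] by simp
  then show ?thesis
    by (auto simp: csubspace_def fixed_space_def pt_stabilizer_def rep_add rep_scaleC)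
qed

lemma fixed_space_closed: "closed (fixed_space G \<pi> A)"
proof -
  have "fixed_space G \<pi> A = (\<Inter>g\<in>pt_stabilizer G A. {\<xi>. \<pi> g \<xi> = \<xi>})"
    by (auto simp: fixed_space_def)
  moreover have "closed {\<xi>. \<pi> g \<xi> = \<xi>}" if "g \<in> pt_stabilizer G A" for g
    using that by (intro closed_Collect_eq unitary_continuous rep_unitary continuous_on_id)
      (auto simp: pt_stabilizer_def)
  ultimately show ?thesis by auto
qed

lemma fixed_space_mono: "A \<subseteq> B \<Longrightarrow> fixed_space G \<pi> A \<subseteq> fixed_space G \<pi> B"
  by (auto simp: fixed_space_def pt_stabilizer_def)

text \<open>
  The images of a vector of \<open>\<H>\<^sub>A\<close> depend only on how the group elements act on \<open>A\<close>. Through this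
  lemma, limits of group elements act on vectors.
\<close>

lemma rep_cong:
  assumes "\<xi> \<in> fixed_space G \<pi> A" "g \<in> carrier G" "h \<in> carrier G" "A \<subseteq> \<Omega>"
    and "\<And>a. a \<in> A \<Longrightarrow> g a = h a"
  shows "\<pi> g \<xi> = \<pi> h \<xi>"
proof -
  have "\<pi> (inv g \<otimes> h) \<xi> = \<xi>"
    using inv_mult_stabilizes[OF assms(2-5)] assms(1) by (simp add: fixed_space_def)
  then have "\<pi> (inv g) (\<pi> h \<xi>) = \<xi>" using assms by (simp add: rep_mult)
  then show ?thesis using rep_inv(2)[OF assms(2), of "\<pi> h \<xi>"] by simp
qed

lemma rep_fixed_space:
  assumes \<xi>: "\<xi> \<in> fixed_space G \<pi> A" and g: "g \<in> carrier G" and A: "A \<subseteq> \<Omega>"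
  shows "\<pi> g \<xi> \<in> fixed_space G \<pi> (g ` A)"
  unfolding fixed_space_def
proof clarify
  fix h assume h: "h \<in> pt_stabilizer G (g ` A)"
  then have hG: "h \<in> carrier G" by (simp add: pt_stabilizer_def)
  have "\<pi> (h \<otimes> g) \<xi> = \<pi> g \<xi>"
    using h hG g A by (intro rep_cong[OF \<xi>]) (auto simp: mult_apply pt_stabilizer_def)
  then show "\<pi> h (\<pi> g \<xi>) = \<pi> g \<xi>" using hG g by (simp add: rep_mult)
qed

text \<open>
  These are the limits of vectors fixed by stabilizers of finite subsets of \<open>D\<close>. The space fixed by the
  pointwise stabilizer of \<open>D\<close> itself would be too large when \<open>D\<close> is infinite: if that stabilizer is
  trivial, it is the whole Hilbert space, and its vectors need not be approximable from inside \<open>D\<close>.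
\<close>

definition support_space :: "'a set \<Rightarrow> 'h set" where
  "support_space D = closure (\<Union>F\<in>{F. finite F \<and> F \<subseteq> D}. fixed_space G \<pi> F)"

lemma support_space_closed: "closed (support_space D)"
  by (simp add: support_space_def)

lemma support_space_csubspace: "csubspace (support_space D)"
  unfolding support_space_def
proof (rule csubspace_closure)
  let ?U = "\<Union>F\<in>{F. finite F \<and> F \<subseteq> D}. fixed_space G \<pi> F"
  have "x + y \<in> ?U" if "x \<in> ?U" "y \<in> ?U" for x y
  proof -
    obtain E F where EF: "finite E" "E \<subseteq> D" "finite F" "F \<subseteq> D"
      and xy: "x \<in> fixed_space G \<pi> E" "y \<in> fixed_space G \<pi> F"
      using \<open>x \<in> ?U\<close> \<open>y \<in> ?U\<close> by auto
    have "x \<in> fixed_space G \<pi> (E \<union> F)" "y \<in> fixed_space G \<pi> (E \<union> F)"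
      using xy fixed_space_mono[of E "E \<union> F"] fixed_space_mono[of F "E \<union> F"] by auto
    then have "x + y \<in> fixed_space G \<pi> (E \<union> F)"
      using fixed_space_csubspace unfolding csubspace_def by blast
    then show ?thesis using EF by (intro UN_I[of "E \<union> F"]) auto
  qed
  moreover have "0 \<in> ?U"
    using fixed_space_csubspace[of "{}"] by (intro UN_I[of "{}"]) (auto simp: csubspace_def)
  moreover have "c *\<^sub>C x \<in> ?U" if "x \<in> ?U" for c x
  proof -
    obtain F where F: "F \<in> {F. finite F \<and> F \<subseteq> D}" "x \<in> fixed_space G \<pi> F" using \<open>x \<in> ?U\<close> by blast
    then have "c *\<^sub>C x \<in> fixed_space G \<pi> F"
      using fixed_space_csubspace[of F] unfolding csubspace_def by blast
    then show ?thesis using F(1) by (rule UN_I[rotated])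
  qed
  ultimately show "csubspace ?U" unfolding csubspace_def by (intro conjI ballI allI)
qed

lemma fixed_space_subset_support_space:
  "finite F \<Longrightarrow> F \<subseteq> D \<Longrightarrow> fixed_space G \<pi> F \<subseteq> support_space D"
  unfolding support_space_def by (rule order_trans[OF _ closure_subset]) blast

lemma support_space_approx:
  assumes "\<xi> \<in> support_space D" "0 < e"
  obtains \<eta> F where "finite F" "F \<subseteq> D" "\<eta> \<in> fixed_space G \<pi> F" "norm (\<xi> - \<eta>) < e"
proof -
  obtain \<eta> where "\<eta> \<in> (\<Union>F\<in>{F. finite F \<and> F \<subseteq> D}. fixed_space G \<pi> F)" "dist \<eta> \<xi> < e"
    using assms unfolding support_space_def closure_approachable by blast
  then show ?thesis using that by (auto simp: dist_norm norm_minus_commute)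
qed

lemma rep_support_space:
  assumes \<xi>: "\<xi> \<in> support_space D" and g: "g \<in> carrier G" and D: "D \<subseteq> \<Omega>" "g ` D \<subseteq> D"
  shows "\<pi> g \<xi> \<in> support_space D"
  unfolding support_space_def closure_approachable
proof (intro allI impI)
  fix e :: real assume "0 < e"
  then obtain \<eta> F where F: "finite F" "F \<subseteq> D" and \<eta>: "\<eta> \<in> fixed_space G \<pi> F" "norm (\<xi> - \<eta>) < e"
    by (rule support_space_approx[OF \<xi>])
  have "\<pi> g \<eta> \<in> fixed_space G \<pi> (g ` F)" using rep_fixed_space[OF \<eta>(1) g] F D by blast
  moreover have "finite (g ` F)" "g ` F \<subseteq> D" using F D by auto
  moreover have "dist (\<pi> g \<eta>) (\<pi> g \<xi>) < e"
    using \<eta>(2) by (simp add: dist_norm unitary_norm_diff rep_unitary[OF g] norm_minus_commute)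
  ultimately show "\<exists>y\<in>\<Union>F\<in>{F. finite F \<and> F \<subseteq> D}. fixed_space G \<pi> F. dist y (\<pi> g \<xi>) < e"
    by blast
qed

text \<open>
  An element of the stabilizer of \<open>B\<close> maps \<open>D\<close> onto itself, so it preserves the support space of \<open>D\<close>
  and commutes with the projection onto it.
\<close>

lemma orth_proj_support_space_fixed:
  assumes y: "y \<in> fixed_space G \<pi> B" and B: "B \<subseteq> \<Omega>" and D: "\<Omega> - B \<subseteq> D" "D \<subseteq> \<Omega>"
  shows "orth_proj (support_space D) y \<in> fixed_space G \<pi> B"
  unfolding fixed_space_def
proof clarify
  fix g assume gB: "g \<in> pt_stabilizer G B"
  let ?P = "orth_proj (support_space D)"
  have g: "g \<in> carrier G" "inv g \<in> carrier G" and gb: "\<And>b. b \<in> B \<Longrightarrow> g b = b"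
    using gB by (auto simp: pt_stabilizer_def)
  have inv_b: "(inv g) b = b" if "b \<in> B" for b using inv_apply[OF g(1), of b] gb that B by auto
  \<comment> \<open>A point of \<open>D\<close> is either fixed or moved within the complement of \<open>B\<close>.\<close>
  have gD: "g x \<in> D" if "x \<in> D" for x
    using that D gb inv_b apply_closed[OF g(1), of x] inv_apply[OF g(1), of x]
    by (metis DiffI subsetD)
  have iD: "(inv g) x \<in> D" if "x \<in> D" for x
    using that D gb inv_b apply_closed[OF g(2), of x] apply_inv[OF g(1), of x]
    by (metis DiffI subsetD)
  note P = orth_proj_props[OF support_space_csubspace[of D] support_space_closed[of D]]
  have "?P y = \<pi> g (?P y)"
  proof (rule orth_proj_eqI[OF support_space_csubspace])
    show "\<pi> g (?P y) \<in> support_space D" using rep_support_space[OF P(1) g(1) D(2)] gD by blast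
    fix z assume z: "z \<in> support_space D"
    have "\<pi> (inv g) z \<in> support_space D" using rep_support_space[OF z g(2) D(2)] iD by blast
    then have "cinner (y - ?P y) (\<pi> (inv g) z) = 0" by (rule P(2))
    then have "cinner (\<pi> g (y - ?P y)) (\<pi> g (\<pi> (inv g) z)) = 0" by (simp add: rep_cinner g)
    moreover have "\<pi> g y = y" using y gB by (simp add: fixed_space_def)
    ultimately show "cinner (y - \<pi> g (?P y)) z = 0" by (simp add: rep_diff rep_inv g)
  qed
  then show "\<pi> g (?P y) = ?P y" by simp
qed

lemma vector_stabilizer_open_subgroup:
  assumes \<xi>: "\<xi> \<in> fixed_space G \<pi> A" and A: "finite A" "A \<subseteq> \<Omega>"
  shows "subgroup {g \<in> carrier G. \<pi> g \<xi> = \<xi>} G"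
    and "openin (pointwise_topology \<Omega> G) {g \<in> carrier G. \<pi> g \<xi> = \<xi>}"
proof -
  let ?V = "{g \<in> carrier G. \<pi> g \<xi> = \<xi>}"
  show "subgroup ?V G"
  proof (rule subgroupI)
    show "?V \<noteq> {}" using rep_one by auto
    show "inv g \<in> ?V" if "g \<in> ?V" for g using that rep_inv(1)[of g \<xi>] by simp
  qed (auto simp: rep_mult)
  show "openin (pointwise_topology \<Omega> G) ?V"
  proof (rule openin_pointwise_topology[OF _ A])
    fix v g assume v: "v \<in> ?V" and g: "g \<in> carrier G" and gv: "\<And>a. a \<in> A \<Longrightarrow> g a = v a"
    then have "\<pi> g \<xi> = \<pi> v \<xi>" by (intro rep_cong[OF \<xi> g _ A(2)]) simp_all
    then show "g \<in> ?V" using v g by simp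
  qed blast
qed

text \<open>
  The stabilizer \<open>V\<close> of \<open>\<xi>\<close> permutes a finite set \<open>S \<subseteq> B\<close> whose pointwise stabilizer is contained
  in \<open>V\<close>. Two maps that split \<open>B - C\<close> have the same effect on \<open>\<xi>\<close>, because \<open>\<xi>\<close> is supported where
  they agree; hence they map \<open>S\<close> to the same set, which forces \<open>S\<close> to avoid \<open>B - C\<close>.
\<close>

lemma fixed_space_inter_support_space:
  assumes split: "splits_finite_sets" and wei: "weakly_eliminates_imaginaries \<Omega> G"
    and B: "finite B" "B \<subseteq> \<Omega>" and C: "C \<subseteq> B"
    and \<xi>: "\<xi> \<in> fixed_space G \<pi> B" "\<xi> \<in> support_space (\<Omega> - (B - C))"
  shows "\<xi> \<in> fixed_space G \<pi> C"
proof -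
  define V where "V = {g \<in> carrier G. \<pi> g \<xi> = \<xi>}"
  have V: "subgroup V G" "openin (pointwise_topology \<Omega> G) V"
    unfolding V_def using vector_stabilizer_open_subgroup[OF \<xi>(1) B] by auto
  obtain D where D: "finite D" "D \<subseteq> \<Omega>" "pt_stabilizer G D \<subseteq> V"
    and idx: "finite (rcosets\<^bsub>G\<lparr>carrier := V\<rparr>\<^esub> (pt_stabilizer G D))"
    using wei V unfolding weakly_eliminates_imaginaries_def by blast
  define S where "S = {v d | v d. v \<in> V \<and> d \<in> D}"
  have finS: "finite S" unfolding S_def by (rule finite_index_orbit[OF V(1) D(1,2) idx])
  have VG: "v \<in> carrier G" if "v \<in> V" for v using that by (simp add: V_def)
  have S\<Omega>: "S \<subseteq> \<Omega>" using D(2) VG apply_closed by (auto simp: S_def)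
  have VS: "v s \<in> S" if "v \<in> V" "s \<in> S" for v s
  proof -
    obtain w d where w: "w \<in> V" "d \<in> D" "s = w d" using \<open>s \<in> S\<close> by (auto simp: S_def)
    then have "v s = (v \<otimes> w) d" using that(1) VG D(2) by (simp add: mult_apply subset_iff)
    then show ?thesis using subgroup.m_closed[OF V(1) that(1) w(1)] w(2) by (auto simp: S_def)
  qed
  have "\<one> \<in> V" using subgroup.one_closed[OF V(1)] .
  have DS: "D \<subseteq> S"
  proof
    fix d assume d: "d \<in> D"
    then have "\<one> d = d" using D(2) by (intro one_apply) blast
    then show "d \<in> S" using \<open>\<one> \<in> V\<close> d by (auto simp: S_def intro!: exI[of _ \<one>] exI[of _ d])
  qed
  have "S - B = {}"
  proof (rule no_algebraicity[OF split B])
    fix g s assume g: "g \<in> pt_stabilizer G B" and s: "s \<in> S - B"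
    have gG: "g \<in> carrier G" "\<And>b. b \<in> B \<Longrightarrow> g b = b" using g by (auto simp: pt_stabilizer_def)
    have "g \<in> V" using g \<xi>(1) by (auto simp: V_def fixed_space_def pt_stabilizer_def)
    then have "g s \<in> S" using VS s by blast
    moreover have "g s \<notin> B"
    proof
      assume b: "g s \<in> B"
      have "s = (inv g) (g (g s))" using inv_apply[OF gG(1), of s] gG(2)[OF b] s S\<Omega> by auto
      also have "\<dots> = g s" using inv_apply[OF gG(1), of "g s"] b B by blast
      finally show False using b s by simp
    qed
    ultimately show "g s \<in> S - B" by blast
  qed (use finS S\<Omega> in auto)
  then have SB: "S \<subseteq> B" by blast

  have BC: "finite (B - C)" "B - C \<subseteq> \<Omega>" using B by auto
  obtain e1 e2 where e: "finitely_approximated e1" "finitely_approximated e2"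
    and eq: "\<forall>x\<in>\<Omega> - (B - C). e1 x = e2 x"
    and sep: "\<forall>x\<in>\<Omega>. \<forall>y\<in>\<Omega>. e1 x = e2 y \<longrightarrow> x = y \<and> x \<notin> B - C"
    by (rule splits_finite_setsE[OF split BC])
  obtain h1 where h1: "h1 \<in> carrier G" "\<forall>x\<in>B. h1 x = e1 x"
    by (rule finitely_approximatedE[OF e(1) B])
  obtain h2 where h2: "h2 \<in> carrier G" "\<forall>x\<in>B. h2 x = e2 x"
    by (rule finitely_approximatedE[OF e(2) B])
  have "norm (\<pi> h1 \<xi> - \<pi> h2 \<xi>) \<le> e" if "0 < e" for e
  proof -
    have "0 < e / 2" using that by simp
    then obtain \<eta> F where F: "finite F" "F \<subseteq> \<Omega> - (B - C)"
      and \<eta>: "\<eta> \<in> fixed_space G \<pi> F" "norm (\<xi> - \<eta>) < e / 2"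
      by (rule support_space_approx[OF \<xi>(2)])
    have BF: "finite (B \<union> F)" "B \<union> F \<subseteq> \<Omega>" using B F by auto
    \<comment> \<open>\<open>h1\<close> and \<open>h2\<close> are prescribed on \<open>B\<close> only and may differ on \<open>F\<close>, so they are replaced by
      approximations on \<open>B \<union> F\<close>, which act in the same way on \<open>\<xi>\<close>.\<close>
    obtain k1 where k1: "k1 \<in> carrier G" "\<forall>x\<in>B \<union> F. k1 x = e1 x"
      by (rule finitely_approximatedE[OF e(1) BF])
    obtain k2 where k2: "k2 \<in> carrier G" "\<forall>x\<in>B \<union> F. k2 x = e2 x"
      by (rule finitely_approximatedE[OF e(2) BF])
    have "\<pi> h1 \<xi> = \<pi> k1 \<xi>" using h1 k1 by (intro rep_cong[OF \<xi>(1) _ _ B(2)]) simp_all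
    moreover have "\<pi> h2 \<xi> = \<pi> k2 \<xi>"
      using h2 k2 by (intro rep_cong[OF \<xi>(1) _ _ B(2)]) simp_all
    moreover have "\<pi> k1 \<eta> = \<pi> k2 \<eta>"
    proof (rule rep_cong[OF \<eta>(1) k1(1) k2(1)])
      show "F \<subseteq> \<Omega>" using F by blast
      show "k1 x = k2 x" if "x \<in> F" for x using that F k1(2) k2(2) eq by (simp add: subset_iff)
    qed
    ultimately have "\<pi> h1 \<xi> - \<pi> h2 \<xi> = (\<pi> k1 \<xi> - \<pi> k1 \<eta>) - (\<pi> k2 \<xi> - \<pi> k2 \<eta>)" by simp
    also have "norm \<dots> \<le> norm (\<pi> k1 \<xi> - \<pi> k1 \<eta>) + norm (\<pi> k2 \<xi> - \<pi> k2 \<eta>)"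
      by (rule norm_triangle_ineq4)
    also have "\<dots> = 2 * norm (\<xi> - \<eta>)"
      using k1(1) k2(1) by (simp add: unitary_norm_diff rep_unitary)
    finally show ?thesis using \<eta>(2) by simp
  qed
  then have "norm (\<pi> h1 \<xi> - \<pi> h2 \<xi>) \<le> 0" by - (rule field_le_epsilon, simp)
  then have "\<pi> h1 \<xi> = \<pi> h2 \<xi>" by simp
  then have "\<pi> (inv h1) (\<pi> h2 \<xi>) = \<xi>" using rep_inv(1)[OF h1(1), of \<xi>] by simp
  then have gV: "inv h1 \<otimes> h2 \<in> V" using h1(1) h2(1) by (simp add: V_def rep_mult)

  have "S \<subseteq> C"
  proof
    fix s assume s: "s \<in> S"
    let ?t = "(inv h1 \<otimes> h2) s"
    have t: "?t \<in> S" using VS[OF gV s] .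
    have "e1 ?t = h1 ?t" using h1(2) t SB by auto
    also have "\<dots> = h2 s"
      using h1(1) h2(1) s S\<Omega> by (simp add: mult_apply apply_inv apply_closed subset_iff)
    also have "\<dots> = e2 s" using h2(2) s SB by auto
    finally have same: "e1 ?t = e2 s" .
    have ts: "?t \<in> \<Omega>" "s \<in> \<Omega>" using t s S\<Omega> by auto
    have "?t = s \<and> ?t \<notin> B - C" using sep[rule_format, OF ts same] .
    then have "?t = s" and "?t \<in> C" using t SB by auto
    then show "s \<in> C" by (simp only:)
  qed
  then have "D \<subseteq> C" using DS by blast
  then have "pt_stabilizer G C \<subseteq> pt_stabilizer G D" by (auto simp: pt_stabilizer_def)
  then have "pt_stabilizer G C \<subseteq> V" using D(3) by blast
  then show ?thesis by (auto simp: fixed_space_def V_def)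
qed

lemma dissociated_rep_if_splits:
  assumes split: "splits_finite_sets" and wei: "weakly_eliminates_imaginaries \<Omega> G"
  shows "dissociated_rep \<Omega> G \<pi>"
  unfolding dissociated_rep_def
proof (intro allI impI ext)
  fix A B x assume A: "finite A" "A \<subseteq> \<Omega>" and B: "finite B" "B \<subseteq> \<Omega>"
  define C where "C = A \<inter> B"
  define D where "D = \<Omega> - (B - C)"
  define y where "y = orth_proj (fixed_space G \<pi> B) x"
  define z where "z = orth_proj (support_space D) y"
  note py = orth_proj_props[OF fixed_space_csubspace[of B] fixed_space_closed[of B],
    where x = x, folded y_def]
  note pz = orth_proj_props[OF support_space_csubspace[of D] support_space_closed[of D],
    where x = y, folded z_def]
  have "z \<in> fixed_space G \<pi> B"
    unfolding z_def by (rule orth_proj_support_space_fixed[OF py(1) B(2)]) (auto simp: D_def)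
  then have zC: "z \<in> fixed_space G \<pi> C"
    using fixed_space_inter_support_space[OF split wei B, of C z] pz(1) by (auto simp: C_def D_def)
  have CA: "fixed_space G \<pi> C \<subseteq> fixed_space G \<pi> A" and CB: "fixed_space G \<pi> C \<subseteq> fixed_space G \<pi> B"
    by (auto simp: C_def intro!: fixed_space_mono)
  have AD: "fixed_space G \<pi> A \<subseteq> support_space D"
    using A by (intro fixed_space_subset_support_space) (auto simp: C_def D_def)
  have "orth_proj (fixed_space G \<pi> A) y = z"
    using zC CA AD pz(2) by (intro orth_proj_eqI[OF fixed_space_csubspace]) auto
  moreover have "orth_proj (fixed_space G \<pi> C) x = z"
  proof (rule orth_proj_eqI[OF fixed_space_csubspace zC])
    fix w assume w: "w \<in> fixed_space G \<pi> C"
    have "cinner (x - z) w = cinner (x - y) w + cinner (y - z) w"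
      by (simp flip: cinner_add_left)
    also have "\<dots> = 0" using w CA CB AD py(2) pz(2) by (metis add_0 subsetD)
    finally show "cinner (x - z) w = 0" .
  qed
  ultimately show "(orth_proj (fixed_space G \<pi> A) \<circ> orth_proj (fixed_space G \<pi> B)) x =
      orth_proj (fixed_space G \<pi> (A \<inter> B)) x"
    by (simp add: C_def y_def)
qed

end

section \<open>Ultrahomogeneous structures\<close>

lemma Aut_permutation_group: "permutation_group (universe M) (Aut M)"
proof (rule permutation_group.intro[OF _ Aut_subgroup])
  show "Aut M = BijGroup (universe M)\<lparr>carrier := carrier (Aut M)\<rparr>" by (simp add: Aut_def)
qed

lemma embedding_comp:
  assumes "embedding f A B" "embedding g B C"
  shows "embedding (g \<circ> f) A C"
proof -
  have "map (g \<circ> f) xs = map g (map f xs)" for xs by simp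
  moreover have "set (map f xs) \<subseteq> universe B" if "set xs \<subseteq> universe A" for xs
    using assms(1) that by (auto simp: embedding_def)
  ultimately have "xs \<in> rel A r \<longleftrightarrow> map (g \<circ> f) xs \<in> rel C r" if "set xs \<subseteq> universe A" for xs r
    using assms that unfolding embedding_def by metis
  moreover have "inj_on (g \<circ> f) (universe A)"
    using assms unfolding embedding_def by (metis comp_inj_on inj_on_subset)
  moreover have "(g \<circ> f) ` universe A \<subseteq> universe C"
    using assms unfolding embedding_def image_comp[symmetric] by blast
  ultimately show ?thesis unfolding embedding_def by (intro conjI allI impI)
qed

lemma embedding_substructure:
  assumes "S \<subseteq> T"
  shows "embedding id (substructure M S) (substructure M T)"
  using assms by (auto simp: embedding_def substructure_def)

lemma substructure_universe: "relational_structure ar M \<Longrightarrow> substructure M (universe M) = M"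
proof -
  assume "relational_structure ar M"
  then have "{xs \<in> rel M r. set xs \<subseteq> universe M} = rel M r" for r
    unfolding relational_structure_def by blast
  then show ?thesis by (simp add: substructure_def)
qed

lemma substructure_in_sigma_age:
  assumes "relational_structure ar M" "S \<subseteq> universe M" "countable S"
  shows "in_sigma_age ar (substructure M S) M"
proof -
  have "relational_structure ar (substructure M S)"
    using assms(1) by (simp add: relational_structure_def substructure_def) blast
  moreover have "isomorphism id (substructure M S) (substructure M S)"
    using embedding_substructure[of S S M] by (simp add: isomorphism_def)
  ultimately show ?thesis using assms by (auto simp: in_sigma_age_def)
qed

text \<open>
  A self-embedding restricts to an isomorphism between finite substructures, and this restriction
  extends to an automorphism.
\<close>

lemma ultrahomogeneous_embedding_approximated:
  assumes uh: "ultrahomogeneous M" and e: "embedding e M M"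
  shows "permutation_group.finitely_approximated (universe M) (Aut M) e"
  unfolding permutation_group.finitely_approximated_def[OF Aut_permutation_group]
proof (intro allI impI)
  fix F assume F: "finite F" "F \<subseteq> universe M"
  have "embedding e (substructure M F) (substructure M (e ` F))"
  proof -
    have "inj_on e F" using e F unfolding embedding_def by (metis inj_on_subset)
    moreover have "xs \<in> rel M r \<longleftrightarrow> map e xs \<in> rel M r" if "set xs \<subseteq> F" for xs r
      using e F that unfolding embedding_def by blast
    ultimately show ?thesis by (auto simp: embedding_def substructure_def)
  qed
  then have "isomorphism e (substructure M F) (substructure M (e ` F))"
    by (simp add: isomorphism_def substructure_def)
  moreover have "e ` F \<subseteq> universe M" using e F by (auto simp: embedding_def)
  ultimately show "\<exists>g\<in>carrier (Aut M). \<forall>x\<in>F. g x = e x"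
    using uh F unfolding ultrahomogeneous_def by blast
qed

text \<open>
  Both sides of the amalgamation are \<open>M\<close> itself, over the substructure on the complement of \<open>S\<close>. The
  amalgam is isomorphic to a substructure of \<open>M\<close>, which makes its two coordinate maps self-embeddings.
\<close>

lemma sigma_SAP_splits_finite_sets:
  fixes M :: "('a, 'r) rel_structure"
  assumes M: "relational_structure ar M" "countable (universe M)"
    and uh: "ultrahomogeneous M" and sap: "sigma_SAP ar M"
  shows "permutation_group.splits_finite_sets (universe M) (Aut M)"
  unfolding permutation_group.splits_finite_sets_def[OF Aut_permutation_group]
proof (intro allI impI)
  fix S assume S: "finite S" "S \<subseteq> universe M"
  let ?N = "substructure M (universe M - S)"
  have univ: "universe ?N = universe M - S" by (simp add: substructure_def)
  have ages: "in_sigma_age ar ?N M" "in_sigma_age ar M M"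
    using substructure_in_sigma_age[OF M(1), of "universe M - S"]
      substructure_in_sigma_age[OF M(1), of "universe M"] M(2)
    by (auto simp: substructure_universe[OF M(1)])
  have incl: "embedding id ?N M"
    using embedding_substructure[of "universe M - S" "universe M" M]
    by (simp add: substructure_universe[OF M(1)])
  have fin: "finite (universe M - id ` universe ?N)"
    using S by (auto simp: univ intro: finite_subset[of _ S])
  obtain N :: "('a, 'r) rel_structure" and g1 g2 where N: "in_sigma_age ar N M" and g: "embedding g1 M N" "embedding g2 M N"
    and eq: "\<forall>a\<in>universe ?N. g1 (id a) = g2 (id a)"
    and strong: "\<forall>b1\<in>universe M. \<forall>b2\<in>universe M. g1 b1 = g2 b2 \<longrightarrow>
      (\<exists>a\<in>universe ?N. id a = b1 \<and> id a = b2)"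
    using sap[unfolded sigma_SAP_def, rule_format, OF ages(1) ages(2) ages(2) incl incl fin fin]
    by (elim exE conjE)
  obtain T f where T: "T \<subseteq> universe M" and f: "isomorphism f N (substructure M T)"
    using N by (auto simp: in_sigma_age_def)
  have fM: "embedding f N M"
    using embedding_comp[of f N "substructure M T" id "substructure M (universe M)"] f
      embedding_substructure[OF T, of M]
    by (simp add: isomorphism_def substructure_universe[OF M(1)])
  have "inj_on f (universe N)" using fM by (simp add: embedding_def)
  moreover have "g1 x \<in> universe N" "g2 x \<in> universe N" if "x \<in> universe M" for x
    using g that by (auto simp: embedding_def)
  ultimately have inj: "g1 x = g2 y"
    if "f (g1 x) = f (g2 y)" "x \<in> universe M" "y \<in> universe M" for x y
    using that by (simp add: inj_on_eq_iff)
  let ?ap = "permutation_group.finitely_approximated (universe M) (Aut M)"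
  have "?ap (f \<circ> g1)" "?ap (f \<circ> g2)"
    by (rule ultrahomogeneous_embedding_approximated[OF uh embedding_comp[OF g(1) fM]],
        rule ultrahomogeneous_embedding_approximated[OF uh embedding_comp[OF g(2) fM]])
  moreover have "\<forall>x\<in>universe M - S. (f \<circ> g1) x = (f \<circ> g2) x" using eq by (simp add: univ)
  moreover have "\<forall>x\<in>universe M. \<forall>y\<in>universe M. (f \<circ> g1) x = (f \<circ> g2) y \<longrightarrow> x = y \<and> x \<notin> S"
  proof (intro ballI impI)
    fix x y assume x: "x \<in> universe M" and y: "y \<in> universe M" and "(f \<circ> g1) x = (f \<circ> g2) y"
    then have "g1 x = g2 y" using inj by simp
    then have "\<exists>a\<in>universe ?N. id a = x \<and> id a = y" by (rule strong[rule_format, OF x y])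
    then show "x = y \<and> x \<notin> S" by (auto simp: univ)
  qed
  ultimately show "\<exists>e1 e2. ?ap e1 \<and> ?ap e2 \<and> (\<forall>x\<in>universe M - S. e1 x = e2 x) \<and>
      (\<forall>x\<in>universe M. \<forall>y\<in>universe M. e1 x = e2 y \<longrightarrow> x = y \<and> x \<notin> S)"
    by (intro exI[of _ "f \<circ> g1"] exI[of _ "f \<circ> g2"] conjI)
qed

theorem theorem4p13:
  fixes ar :: "'r \<Rightarrow> nat" and M :: "('a, 'r) rel_structure"
  assumes "relational_structure ar M"
    and "countable (universe M)" and "infinite (universe M)"
    and "ultrahomogeneous M"
    and "weakly_eliminates_imaginaries (universe M) (Aut M)"
    and "sigma_SAP ar M"
  shows "dissociated TYPE('h::chilbert_space) (universe M) (Aut M)"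
  unfolding dissociated_def
proof (intro allI impI)
  fix \<pi> :: "('a \<Rightarrow> 'a) \<Rightarrow> 'h \<Rightarrow> 'h" assume "unitary_rep (universe M) (Aut M) \<pi>"
  then interpret unitary_representation "universe M" "Aut M" \<pi>
    using Aut_permutation_group[of M]
    by (simp add: unitary_rep_def unitary_representation_def unitary_representation_axioms_def)
  show "dissociated_rep (universe M) (Aut M) \<pi>"
    using dissociated_rep_if_splits[OF sigma_SAP_splits_finite_sets assms(5)] assms by blast
qed

end
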